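(* Let $\mu$ be a nonzero finite Borel measure on $\mathbb{R}^d$ that is singular with respect to Lebesgue measure. Suppose there are real constants $C>0$ and $\gamma$ such that $|\widehat\mu(\xi)|^2\le C|\xi|^{-\gamma}$ for all $\xi\in\mathbb{R}^d$ with $|\xi|$ large enough. Let $\Lambda\subset\mathbb{R}^d$ be a discrete (countable) set such that there exists $A>0$ with $$A\|f\|_{L^2(\mu)}^2\le\sum_{\lambda\in\Lambda}\left|\int f(x)e^{-2\pi i\lambda\cdot x}\,d\mu(x)\right|^2\qquad\text{for all } f\in L^2(\mu).$$ Then $\gamma\le\dim^+(\Lambda)$.
   Context: The Fourier transform of a finite Borel measure $\mu$ on $\mathbb{R}^d$ is $\widehat\mu(\xi)=\int e^{-2\pi i\xi\cdot x}\,d\mu(x)$. For a discrete set $\Lambda\subset\mathbb{R}^d$ and $r>0$, put $D_r^+(\Lambda)=\limsup_{h\to\infty}\sup_{x\in\mathbb{R}^d}\frac{\#(\Lambda\cap Q_h^d(x))}{h^r}$ with $Q_h^d(x)=x+[-h,h]^d$. The (upper) Beurling dimension is $\dim^+(\Lambda)=\sup\{r>0:D_r^+(\Lambda)>0\}=\inf\{r>0:D_r^+(\Lambda)<\infty\}$ (with $\sup\emptyset=0$, $\inf\emptyset=\infty$). *)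

theory Defs
  imports "HOL-Analysis.Analysis"
begin

definition measure_fourier :: "(real ^ 'n) measure \<Rightarrow> real ^ 'n \<Rightarrow> complex" where
  "measure_fourier M \<xi> = (\<integral>x. cis (- 2 * pi * (\<xi> \<bullet> x)) \<partial>M)"

definition mutually_singular :: "'a measure \<Rightarrow> 'a measure \<Rightarrow> bool" where
  "mutually_singular M N \<longleftrightarrow>
     (\<exists>S \<in> sets M \<inter> sets N. emeasure M (space M - S) = 0 \<and> emeasure N S = 0)"

text \<open>Elements of complex \<open>L\<^sup>2(M)\<close> are represented by functions rather than by
  almost-everywhere classes.\<close>

definition square_integrable :: "'a measure \<Rightarrow> ('a \<Rightarrow> complex) \<Rightarrow> bool" where
  "square_integrable M f \<longleftrightarrow>
     f \<in> borel_measurable M \<and> integrable M (\<lambda>x. (cmod (f x))\<^sup>2)"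

definition cube :: "real \<Rightarrow> real ^ 'n \<Rightarrow> (real ^ 'n) set" where
  "cube h x = (+) x ` cbox (\<chi> i. - h) (\<chi> i. h)"

text \<open>The number of points is taken with respect to the counting measure, because
  \<open>card\<close> is \<open>0\<close> on infinite sets. The case \<open>h \<le> 0\<close> plays no role in the limit.\<close>

definition upper_density :: "real \<Rightarrow> (real ^ 'n) set \<Rightarrow> ennreal" where
  "upper_density r \<Lambda> =
     Limsup at_top (\<lambda>h::real.
       SUP x. emeasure (count_space UNIV) (\<Lambda> \<inter> cube h x) / ennreal (h powr r))"

text \<open>In \<^typ>\<open>ennreal\<close> the supremum of the empty set is \<open>0\<close> and its infimum is \<open>\<infinity>\<close>.\<close>

definition upper_beurling_dim :: "(real ^ 'n) set \<Rightarrow> ennreal" where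
  "upper_beurling_dim \<Lambda> = (SUP r \<in> {r::real. 0 < r \<and> 0 < upper_density r \<Lambda>}. ennreal r)"

lemma upper_density_eq_0:
  fixes \<Lambda> :: "(real ^ 'n) set"
  assumes "s < r" "upper_density s \<Lambda> < \<infinity>"
  shows "upper_density r \<Lambda> = 0"
proof -
  define g where "g h x = emeasure (count_space UNIV) (\<Lambda> \<inter> cube h x)" for h and x :: "real ^ 'n"
  obtain d where "upper_density s \<Lambda> = ennreal d" "0 \<le> d"
    using assms(2) by (cases "upper_density s \<Lambda>") auto
  then obtain c where c: "upper_density s \<Lambda> < ennreal c" "0 < c"
    using that[of "d + 1"] by (simp add: ennreal_less_iff)
  then have ev: "eventually (\<lambda>h. (SUP x. g h x / ennreal (h powr s)) < ennreal c) at_top"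
    unfolding upper_density_def g_def by (intro Limsup_lessD) auto
  have ev2: "eventually (\<lambda>h. (SUP x. g h x / ennreal (h powr r)) \<le> ennreal (c * h powr (s - r))) at_top"
    using ev eventually_gt_at_top[of 0]
  proof eventually_elim
    case (elim h)
    show ?case
    proof (rule SUP_least)
      fix x
      have "g h x / ennreal (h powr s) \<le> ennreal c"
        using elim by (meson SUP_upper UNIV_I le_less_trans less_imp_le)
      then have "g h x / ennreal (h powr s) * ennreal (h powr (s - r)) \<le> ennreal c * ennreal (h powr (s - r))"
        by (rule mult_right_mono) simp
      also have "ennreal c * ennreal (h powr (s - r)) = ennreal (c * h powr (s - r))"
        using c by (simp add: ennreal_mult)
      also have "g h x / ennreal (h powr s) * ennreal (h powr (s - r)) = g h x / ennreal (h powr r)"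
        using elim by (simp add: divide_ennreal_def inverse_ennreal mult.assoc powr_diff
            flip: ennreal_mult) (simp add: field_simps)
      finally show "g h x / ennreal (h powr r) \<le> ennreal (c * h powr (s - r))" .
    qed
  qed
  have "((\<lambda>h::real. c * h powr (s - r)) \<longlongrightarrow> c * 0) at_top"
    using assms(1) by (intro tendsto_mult tendsto_const tendsto_neg_powr filterlim_ident) auto
  then have lim: "((\<lambda>h::real. ennreal (c * h powr (s - r))) \<longlongrightarrow> 0) at_top"
    by (metis ennreal_0 mult_zero_right tendsto_ennrealI)
  have "upper_density r \<Lambda> \<le> Limsup at_top (\<lambda>h::real. ennreal (c * h powr (s - r)))"
    unfolding upper_density_def using ev2 unfolding g_def by (rule Limsup_mono)
  also have "\<dots> = 0"
    using lim by (intro lim_imp_Limsup) auto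
  finally show ?thesis by simp
qed

lemma upper_beurling_dim_eq_INF:
  "upper_beurling_dim \<Lambda> = (INF r \<in> {r::real. 0 < r \<and> upper_density r \<Lambda> < \<infinity>}. ennreal r)"
proof (rule antisym)
  show "upper_beurling_dim \<Lambda> \<le> (INF r \<in> {r::real. 0 < r \<and> upper_density r \<Lambda> < \<infinity>}. ennreal r)"
    unfolding upper_beurling_dim_def
  proof (intro SUP_least INF_greatest ennreal_leI, clarsimp)
    fix r s assume *: "0 < upper_density r \<Lambda>" "upper_density s \<Lambda> < top"
    show "r \<le> s"
      using upper_density_eq_0[of s r \<Lambda>] * by (cases "r \<le> s") auto
  qed
next
  show "(INF r \<in> {r::real. 0 < r \<and> upper_density r \<Lambda> < \<infinity>}. ennreal r) \<le> upper_beurling_dim \<Lambda>"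
  proof (rule dense_ge)
    fix y assume y: "upper_beurling_dim \<Lambda> < y"
    show "(INF r \<in> {r::real. 0 < r \<and> upper_density r \<Lambda> < \<infinity>}. ennreal r) \<le> y"
    proof (cases y)
      case (real t)
      have t: "0 < t" using y real by (metis ennreal_0 less_eq_real_def not_less_zero)
      have "upper_density t \<Lambda> = 0"
      proof (rule ccontr)
        assume "upper_density t \<Lambda> \<noteq> 0"
        then have "ennreal t \<le> upper_beurling_dim \<Lambda>"
          unfolding upper_beurling_dim_def using t by (intro SUP_upper) (auto simp: zero_less_iff_neq_zero)
        then show False using y real by simp
      qed
      then show ?thesis using t real by (intro INF_lower2[of t]) auto
    qed auto
  qed
qed

end

theory Submission
  imports Defs
begin

text \<open>Suppose \<open>\<Lambda>\<close> has Beurling dimension below \<open>\<gamma>\<close>, so that balls of radius \<open>h\<close> contain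
  \<open>O(h powr r)\<close> points of \<open>\<Lambda>\<close> for some \<open>r < \<gamma>\<close>. The frame inequality for the character of frequency
  \<open>\<xi>\<close> bounds \<open>\<Sum>\<^sub>\<lambda> |\<mu>^(\<lambda> - \<xi>)|\<^sup>2\<close> from below, while the decay of \<open>\<mu>^\<close> makes the part with
  \<open>|\<lambda> - \<xi>| \<ge> R\<close> small uniformly in \<open>\<xi>\<close>. Hence \<open>\<Lambda>\<close> meets every ball of a fixed radius \<open>R\<close>,
  the volume of balls is itself \<open>O(h powr r)\<close>, and \<open>\<mu>^\<close> is square integrable.
  Then \<open>\<mu>\<close> is absolutely continuous. Instead of Plancherel's theorem, Fubini's theorem turns
  \<open>\<integral>\<integral> |\<nu>^(y - z)|\<^sup>2 d\<mu> d\<mu>\<close> into \<open>\<integral>\<integral> |\<mu>^(s - t)|\<^sup>2 d\<nu> d\<nu>\<close>; taking for \<open>\<nu>\<close> Lebesgue measure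
  on a ball of radius \<open>1 / (12 \<epsilon>)\<close> shows that \<open>\<mu> \<times> \<mu>\<close> gives mass \<open>O(\<epsilon>^d)\<close> to the pairs at distance
  less than \<open>2 \<epsilon>\<close>, which is a uniform \<open>L\<^sup>2\<close> bound on the averages of \<open>\<mu>\<close> over \<open>\<epsilon>\<close>-balls.\<close>

section \<open>Power tails, point counts and sums over discrete sets\<close>

text \<open>Dyadic decomposition: where \<open>2 ^ k * R \<le> N x < 2 ^ Suc k * R\<close> the
  integrand is at most \<open>(2 ^ k * R) powr - g\<close>, and \<open>growth\<close> bounds the
  mass there, so the shells sum to a geometric series of ratio \<open>2 powr (r - g)\<close>. The
  measure is general because the lemma serves both counting measure on \<open>\<Lambda>\<close> and
  Lebesgue measure.\<close>

lemma nn_integral_powr_tail: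
  fixes N :: "'a \<Rightarrow> real"
  assumes [measurable]: "N \<in> borel_measurable M"
    and R: "0 < R" and c: "0 \<le> c" and g: "0 \<le> g" "r < g"
    and growth: "\<And>h. R \<le> h \<Longrightarrow> emeasure M {x\<in>space M. N x \<le> h} \<le> ennreal (c * h powr r)"
  shows "(\<integral>\<^sup>+x. ennreal (N x powr - g) * indicator {x. R \<le> N x} x \<partial>M)
    \<le> ennreal (c * 2 powr r / (1 - 2 powr (r - g)) * R powr (r - g))"
proof -
  define q :: real where "q = 2 powr (r - g)"
  have q: "0 < q" "q < 1"
    using g by (auto simp: q_def powr_less_one)
  define a where "a k = ennreal ((2 ^ k * R) powr - g)" for k :: nat
  define S where "S k = {x \<in> space M. N x \<le> 2 ^ Suc k * R}" for k :: nat
  have [measurable]: "S k \<in> sets M" for k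
    unfolding S_def by measurable
  \<comment> \<open>The \<open>S k\<close> are whole sublevel sets, not disjoint shells; the
    integrand at a point is compared with a single term of the series.\<close>
  have term_le: "t j \<le> (\<Sum>k. t k)" for t :: "nat \<Rightarrow> ennreal" and j
    using sum_le_suminf[OF summableI, of "{j}" t] by simp
  have "(\<integral>\<^sup>+x. ennreal (N x powr - g) * indicator {x. R \<le> N x} x \<partial>M)
    \<le> (\<integral>\<^sup>+x. (\<Sum>k. a k * indicator (S k) x) \<partial>M)"
  proof (rule nn_integral_mono)
    fix x assume x: "x \<in> space M"
    show "ennreal (N x powr - g) * indicator {x. R \<le> N x} x \<le> (\<Sum>k. a k * indicator (S k) x)"
    proof (cases "R \<le> N x")
      case True
      define P where "P k \<longleftrightarrow> N x < 2 ^ k * R" for k :: nat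
      obtain k0 :: nat where "N x / R < 2 ^ k0"
        using real_arch_pow[of 2 "N x / R"] by auto
      then have ex: "P k0"
        using R by (simp add: P_def field_simps)
      \<comment> \<open>This least index is positive since \<open>R \<le> N x\<close>; its
        predecessor \<open>j\<close> is the index of the shell containing \<open>x\<close>.\<close>
      define k where "k = (LEAST k. P k)"
      have Pk: "P k"
        unfolding k_def by (rule LeastI[of P, OF ex])
      have "k \<noteq> 0"
        using Pk True by (intro notI) (simp add: P_def)
      then obtain j where j: "k = Suc j"
        by (cases k) auto
      then have "\<not> P j"
        unfolding k_def by (metis lessI not_less_Least)
      then have lo: "2 ^ j * R \<le> N x"
        by (simp add: P_def)
      have "N x powr - g \<le> (2 ^ j * R) powr - g"
        using lo R g by (intro powr_mono2') auto
      moreover have "x \<in> S j"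
        using Pk x by (simp add: S_def P_def j)
      ultimately have "ennreal (N x powr - g) * indicator {x. R \<le> N x} x \<le> a j * indicator (S j) x"
        using True by (simp add: a_def ennreal_leI)
      also have "\<dots> \<le> (\<Sum>k. a k * indicator (S k) x)"
        by (rule term_le)
      finally show ?thesis .
    qed auto
  qed
  also have "\<dots> = (\<Sum>k. a k * emeasure M (S k))"
    by (subst nn_integral_suminf) (auto simp: nn_integral_cmult_indicator)
  also have "\<dots> \<le> (\<Sum>k. ennreal (c * 2 powr r * R powr (r - g) * q ^ k))"
  proof (intro suminf_le summableI)
    fix k
    have "R \<le> 2 ^ Suc k * R"
      using R by (simp add: mult_ge1_I[of "2::real"] order.trans[OF one_le_power[of 2 k]] del: power_Suc)
    then have "a k * emeasure M (S k) \<le> a k * ennreal (c * (2 ^ Suc k * R) powr r)"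
      unfolding S_def by (intro mult_left_mono growth) auto
    also have "\<dots> = ennreal ((2 ^ k * R) powr - g * (c * (2 ^ Suc k * R) powr r))"
      using c by (simp add: a_def ennreal_mult)
    also have "(2 ^ k * R) powr - g * (c * (2 ^ Suc k * R) powr r) = c * 2 powr r * R powr (r - g) * q ^ k"
    proof -
      have p: "(2::real) ^ k = 2 powr real k"
        by (simp add: powr_realpow)
      have "(2 ^ k * R) powr - g = 2 powr (- (real k * g)) * R powr (- g)"
        using R by (simp add: p powr_mult powr_powr)
      moreover have "(2 ^ Suc k * R) powr r = 2 powr r * 2 powr (real k * r) * R powr r"
        using R by (simp add: p powr_mult powr_powr)
      moreover have "q ^ k = 2 powr (real k * r) * 2 powr (- (real k * g))"
        by (simp add: q_def powr_realpow[symmetric] powr_powr algebra_simps flip: powr_add)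
      moreover have "R powr (r - g) = R powr r * R powr (- g)"
        by (simp flip: powr_add)
      ultimately show ?thesis by simp
    qed
    finally show "a k * emeasure M (S k) \<le> ennreal (c * 2 powr r * R powr (r - g) * q ^ k)" .
  qed
  also have "\<dots> = ennreal (c * 2 powr r * R powr (r - g) * (1 / (1 - q)))"
    using q c by (intro suminf_ennreal_eq sums_mult geometric_sums) auto
  finally show ?thesis
    by (simp add: q_def)
qed

text \<open>Extracts from the limsup a bound uniform in the centre. Passing from cubes to balls is
  free, since every coordinate of a vector is at most its norm.\<close>

lemma upper_density_finite_count:
  fixes \<Lambda> :: "(real ^ 'n) set"
  assumes "upper_density r \<Lambda> < \<infinity>"
  obtains c R where "0 \<le> c" "0 < R"
    "\<And>h x. R \<le> h \<Longrightarrow> emeasure (count_space UNIV) (\<Lambda> \<inter> cball x h) \<le> ennreal (c * h powr r)"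
proof -
  obtain d where "upper_density r \<Lambda> = ennreal d" "0 \<le> d"
    using assms by (cases "upper_density r \<Lambda>") auto
  then obtain c where c: "upper_density r \<Lambda> < ennreal c" "0 < c"
    using that[of "d + 1"] by (simp add: ennreal_less_iff)
  then have "eventually (\<lambda>h. (SUP x. emeasure (count_space UNIV) (\<Lambda> \<inter> cube h x) / ennreal (h powr r)) < ennreal c) at_top"
    unfolding upper_density_def by (intro Limsup_lessD) auto
  then obtain R0 where R0: "\<And>h. R0 \<le> h \<Longrightarrow>
      (SUP x. emeasure (count_space UNIV) (\<Lambda> \<inter> cube h x) / ennreal (h powr r)) < ennreal c"
    by (auto simp: eventually_at_top_linorder)
  show ?thesis
  \<comment> \<open>The \<open>1\<close> keeps \<open>h\<close> positive, so that the factor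
    \<open>h powr r\<close> can be cancelled.\<close>
  proof (rule that[of c "max R0 1"])
    fix h and x :: "real ^ 'n"
    assume h: "max R0 1 \<le> h"
    have "cball x h \<subseteq> cube h x"
    proof
      fix y assume "y \<in> cball x h"
      then have "norm (y - x) \<le> h"
        by (simp add: dist_norm norm_minus_commute)
      then have "\<bar>(y - x) $ i\<bar> \<le> h" for i
        using component_le_norm_cart order_trans by blast
      then have "y - x \<in> cbox (\<chi> i. - h) (\<chi> i. h)"
        unfolding mem_box_cart by (auto simp: abs_le_iff intro: minus_le_iff[THEN iffD1])
      then show "y \<in> cube h x"
        unfolding cube_def by (intro image_eqI[of _ _ "y - x"]) auto
    qed
    then have "emeasure (count_space UNIV) (\<Lambda> \<inter> cball x h) \<le> emeasure (count_space UNIV) (\<Lambda> \<inter> cube h x)"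
      by (intro emeasure_mono) auto
    also have "\<dots> = emeasure (count_space UNIV) (\<Lambda> \<inter> cube h x) / ennreal (h powr r) * ennreal (h powr r)"
      using h by (simp add: divide_ennreal_def mult.assoc inverse_ennreal flip: ennreal_mult)
    also have "emeasure (count_space UNIV) (\<Lambda> \<inter> cube h x) / ennreal (h powr r) \<le> ennreal c"
      using R0[of h] h by (meson SUP_upper UNIV_I le_less_trans less_imp_le max.boundedE)
    finally show "emeasure (count_space UNIV) (\<Lambda> \<inter> cball x h) \<le> ennreal (c * h powr r)"
      using c by (simp add: ennreal_mult mult_right_mono)
  qed (use c in auto)
qed

text \<open>Turns the frame sum into an integral over counting measure, where
  \<open>nn_integral_powr_tail\<close> applies. The sum is the supremum of its finite partial sums,
  each of which is the integral over a finite subset.\<close>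

lemma infsum_ennreal_le_nn_integral:
  fixes f :: "'a \<Rightarrow> ennreal"
  shows "(\<Sum>\<^sub>\<infinity>x\<in>A. f x) \<le> (\<integral>\<^sup>+x. f x \<partial>count_space A)"
proof (subst nonneg_infsum_complete)
  show "(SUP F\<in>{F. finite F \<and> F \<subseteq> A}. sum f F) \<le> (\<integral>\<^sup>+x. f x \<partial>count_space A)"
  proof (rule SUP_least, clarify)
    fix F assume F: "finite F" "F \<subseteq> A"
    have "sum f F = (\<integral>\<^sup>+x. f x \<partial>count_space F)"
      using F by (simp add: nn_integral_count_space_finite)
    also have "\<dots> = (\<integral>\<^sup>+x. f x * indicator F x \<partial>count_space A)"
      using F by (auto simp: nn_integral_count_space_indicator indicator_def intro!: nn_integral_cong)
    also have "\<dots> \<le> (\<integral>\<^sup>+x. f x \<partial>count_space A)"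
      by (intro nn_integral_mono) (auto simp: indicator_def)
    finally show "sum f F \<le> (\<integral>\<^sup>+x. f x \<partial>count_space A)" .
  qed
qed simp

section \<open>Fourier transforms of finite measures and their duality\<close>

lemma measurable_cis [measurable]:
  assumes "g \<in> borel_measurable M"
  shows "(\<lambda>x. cis (g x)) \<in> borel_measurable M"
  unfolding cis.code Complex_eq using assms by measurable

lemma (in finite_measure) integrable_cis:
  assumes "g \<in> borel_measurable M"
  shows "integrable M (\<lambda>x. cis (g x))"
  using assms by (intro integrable_const_bound[where B = 1]) auto

lemma borel_measurable_measure_fourier:
  fixes M :: "(real ^ 'n) measure"
  assumes "finite_measure M" and [measurable_cong]: "sets M = sets borel"
  shows "measure_fourier M \<in> borel_measurable borel"
proof -
  interpret finite_measure M by fact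
  show ?thesis
    unfolding measure_fourier_def by measurable
qed

lemma cmod_measure_fourier_le:
  fixes M :: "(real ^ 'n) measure"
  assumes "finite_measure M" "sets M = sets borel"
  shows "cmod (measure_fourier M \<xi>) \<le> measure M (space M)"
proof -
  interpret finite_measure M by fact
  show ?thesis
    unfolding measure_fourier_def
    by (rule order_trans[OF integral_norm_bound]) simp
qed

text \<open>Fubini applied to the product of the transform with its conjugate. The left side is cast
  to complex so that the equation can rewrite integrands in the duality below.\<close>

lemma norm_square_measure_fourier:
  fixes M :: "(real ^ 'n) measure"
  assumes "finite_measure M" and [measurable_cong]: "sets M = sets borel"
  shows "complex_of_real ((cmod (measure_fourier M \<xi>))\<^sup>2) =
    (\<integral>q. cis (- 2 * pi * (\<xi> \<bullet> (fst q - snd q))) \<partial>(M \<Otimes>\<^sub>M M))"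
proof -
  interpret finite_measure M by fact
  interpret P: pair_sigma_finite M M ..
  interpret PP: finite_measure "M \<Otimes>\<^sub>M M"
    using assms by (intro finite_measure_pair_measure)
  have "(\<integral>q. cis (- 2 * pi * (\<xi> \<bullet> (fst q - snd q))) \<partial>(M \<Otimes>\<^sub>M M))
    = (\<integral>s. \<integral>t. cis (- 2 * pi * (\<xi> \<bullet> s)) * cnj (cis (- 2 * pi * (\<xi> \<bullet> t))) \<partial>M \<partial>M)"
    by (subst P.integral_fst'[symmetric], rule PP.integrable_cis, measurable)
       (simp add: cis_cnj cis_mult algebra_simps)
  also have "\<dots> = (\<integral>s. cis (- 2 * pi * (\<xi> \<bullet> s)) * cnj (measure_fourier M \<xi>) \<partial>M)"
    by (simp add: measure_fourier_def del: cis_cnj)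
  also have "\<dots> = measure_fourier M \<xi> * cnj (measure_fourier M \<xi>)"
    by (simp add: measure_fourier_def)
  finally show ?thesis
    by (simp only: complex_norm_square)
qed

text \<open>Both sides are the integral over all four variables of one kernel, the character at
  \<open>(fst p - snd p) \<bullet> (fst q - snd q)\<close>, which is symmetric in the two
  differences. It has modulus 1 and the measures are finite, so Fubini applies.\<close>

lemma measure_fourier_duality:
  fixes M N :: "(real ^ 'n) measure"
  assumes M: "finite_measure M" and sM [measurable_cong]: "sets M = sets borel"
    and N: "finite_measure N" and sN [measurable_cong]: "sets N = sets borel"
  shows "(\<integral>\<^sup>+p. ennreal ((cmod (measure_fourier N (fst p - snd p)))\<^sup>2) \<partial>(M \<Otimes>\<^sub>M M))
    = (\<integral>\<^sup>+q. ennreal ((cmod (measure_fourier M (fst q - snd q)))\<^sup>2) \<partial>(N \<Otimes>\<^sub>M N))"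
proof -
  interpret MM: finite_measure "M \<Otimes>\<^sub>M M"
    using M by (intro finite_measure_pair_measure)
  interpret NN: finite_measure "N \<Otimes>\<^sub>M N"
    using N by (intro finite_measure_pair_measure)
  interpret P: pair_sigma_finite "M \<Otimes>\<^sub>M M" "N \<Otimes>\<^sub>M N" ..
  interpret PP: finite_measure "(M \<Otimes>\<^sub>M M) \<Otimes>\<^sub>M (N \<Otimes>\<^sub>M N)"
    by (intro finite_measure_pair_measure MM.finite_measure_axioms NN.finite_measure_axioms)
  \<comment> \<open>Fubini is carried out for complex Bochner integrals; this integrability carries
    the equality over to nonnegative integrals at the end.\<close>
  have int: "integrable (L \<Otimes>\<^sub>M L) (\<lambda>p. (cmod (measure_fourier K (fst p - snd p)))\<^sup>2)"
    if L: "finite_measure L" "sets L = sets borel" and K: "finite_measure K" "sets K = sets borel"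
    for K L :: "(real ^ 'n) measure"
  proof -
    interpret LL: finite_measure "L \<Otimes>\<^sub>M L"
      using L by (intro finite_measure_pair_measure)
    note [measurable] = borel_measurable_measure_fourier[OF K]
    note [measurable_cong] = L(2)
    have "(cmod (measure_fourier K \<xi>))\<^sup>2 \<le> (measure K (space K))\<^sup>2" for \<xi>
      by (intro power_mono cmod_measure_fourier_le K) auto
    then show ?thesis
      by (intro LL.integrable_const_bound[where B = "(measure K (space K))\<^sup>2"]) auto
  qed
  have "complex_of_real (\<integral>p. (cmod (measure_fourier N (fst p - snd p)))\<^sup>2 \<partial>(M \<Otimes>\<^sub>M M))
     = (\<integral>p. \<integral>q. cis (- 2 * pi * ((fst p - snd p) \<bullet> (fst q - snd q))) \<partial>(N \<Otimes>\<^sub>M N) \<partial>(M \<Otimes>\<^sub>M M))"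
    by (simp only: norm_square_measure_fourier[OF N sN] flip: integral_complex_of_real)
  also have "\<dots> = (\<integral>q. \<integral>p. cis (- 2 * pi * ((fst p - snd p) \<bullet> (fst q - snd q))) \<partial>(M \<Otimes>\<^sub>M M) \<partial>(N \<Otimes>\<^sub>M N))"
    unfolding split_beta' by (rule P.Fubini_integral[symmetric]) (unfold split_beta', rule PP.integrable_cis, measurable)
  also have "\<dots> = complex_of_real (\<integral>q. (cmod (measure_fourier M (fst q - snd q)))\<^sup>2 \<partial>(N \<Otimes>\<^sub>M N))"
    by (simp only: norm_square_measure_fourier[OF M sM] inner_commute flip: integral_complex_of_real)
  finally show ?thesis
    using int[OF M sM N sN] int[OF N sN M sM] by (simp add: nn_integral_eq_integral)
qed

section \<open>Mass of pairs of close points\<close>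

lemma nn_integral_lborel_diff:
  fixes f :: "'a::euclidean_space \<Rightarrow> ennreal"
  assumes [measurable]: "f \<in> borel_measurable borel"
  shows "(\<integral>\<^sup>+s. f (s - t) \<partial>lborel) = (\<integral>\<^sup>+s. f s \<partial>lborel)"
proof -
  have "(\<integral>\<^sup>+s. f s \<partial>distr lborel borel ((+) (- t))) = (\<integral>\<^sup>+s. f (- t + s) \<partial>lborel)"
    by (rule nn_integral_distr) auto
  then show ?thesis
    by (simp add: lborel_distr_plus)
qed

text \<open>For fixed \<open>t\<close>, dropping the restriction of \<open>s\<close> to
  \<open>Q\<close> leaves a translate of the full integral of \<open>f\<close>; integrating this
  constant over \<open>t\<close> contributes the volume of \<open>Q\<close>.\<close>

lemma nn_integral_difference_restricted_le:
  fixes f :: "'a::euclidean_space \<Rightarrow> ennreal"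
  assumes [measurable]: "f \<in> borel_measurable borel" "Q \<in> sets borel"
    and fin: "finite_measure (density lborel (indicator Q))"
  shows "(\<integral>\<^sup>+q. f (fst q - snd q) \<partial>(density lborel (indicator Q) \<Otimes>\<^sub>M density lborel (indicator Q)))
    \<le> emeasure lborel Q * (\<integral>\<^sup>+s. f s \<partial>lborel)"
proof -
  define N where "N = density lborel (indicator Q)"
  have sN [measurable_cong]: "sets N = sets borel"
    by (simp add: N_def)
  interpret finite_measure N
    using fin by (simp add: N_def)
  interpret P: pair_sigma_finite N N ..
  have "(\<integral>\<^sup>+q. f (fst q - snd q) \<partial>(N \<Otimes>\<^sub>M N)) = (\<integral>\<^sup>+t. \<integral>\<^sup>+s. f (s - t) \<partial>N \<partial>N)"
    by (subst P.nn_integral_snd[symmetric]) auto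
  also have "\<dots> \<le> (\<integral>\<^sup>+t. (\<integral>\<^sup>+s. f s \<partial>lborel) \<partial>N)"
  proof (rule nn_integral_mono)
    fix t
    have "(\<integral>\<^sup>+s. f (s - t) \<partial>N) = (\<integral>\<^sup>+s. indicator Q s * f (s - t) \<partial>lborel)"
      unfolding N_def by (rule nn_integral_density) auto
    also have "\<dots> \<le> (\<integral>\<^sup>+s. f (s - t) \<partial>lborel)"
      by (intro nn_integral_mono) (auto simp: indicator_def)
    finally show "(\<integral>\<^sup>+s. f (s - t) \<partial>N) \<le> (\<integral>\<^sup>+s. f s \<partial>lborel)"
      by (simp add: nn_integral_lborel_diff)
  qed
  also have "\<dots> = emeasure lborel Q * (\<integral>\<^sup>+s. f s \<partial>lborel)"
    by (simp add: N_def emeasure_density mult.commute)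
  finally show ?thesis
    by (simp add: N_def)
qed

text \<open>Duality is applied to Lebesgue measure on a ball of radius \<open>1 / (12 * e)\<close>: its transform
  has real part at least half the volume of the ball wherever \<open>norm x < 2 * e\<close>, since the phases
  then stay within \<open>pi / 3\<close>.\<close>

lemma emeasure_close_pairs_le:
  fixes M :: "(real ^ 'n) measure"
  assumes M: "finite_measure M" and sM [measurable_cong]: "sets M = sets borel" and e: "0 < e"
  shows "emeasure (M \<Otimes>\<^sub>M M) {p. dist (fst p) (snd p) < 2 * e} * emeasure lborel (ball (0 :: real ^ 'n) (1 / (12 * e)))
    \<le> 4 * (\<integral>\<^sup>+\<xi>. ennreal ((cmod (measure_fourier M \<xi>))\<^sup>2) \<partial>lborel)"
    (is "?X * _ \<le> 4 * ?E")
proof -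
  define Q where "Q = ball (0 :: real ^ 'n) (1 / (12 * e))"
  define V where "V = measure lborel Q"
  have V: "emeasure lborel Q = ennreal V" "0 < V"
  proof -
    show "emeasure lborel Q = ennreal V"
      unfolding V_def Q_def using emeasure_lborel_ball_finite
      by (metis emeasure_eq_ennreal_measure less_irrefl infinity_ennreal_def)
    then show "0 < V"
      using e by (simp add: Q_def emeasure_ball)
        (metis ennreal_inj less_eq_real_def mult_pos_pos of_nat_0_le_iff unit_ball_vol_pos V_def measure_nonneg
          zero_less_divide_1_iff zero_less_mult_iff zero_less_numeral zero_less_power)
  qed
  define N where "N = density lborel (indicator Q)"
  have [measurable]: "Q \<in> sets borel"
    by (simp add: Q_def)
  have sN [measurable_cong]: "sets N = sets borel"
    by (simp add: N_def)
  have spN: "emeasure N (space N) = ennreal V"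
    by (simp add: N_def emeasure_density V)
  then have N: "finite_measure N"
    by (intro finite_measureI) simp
  interpret N: finite_measure N by (fact N)
  note [measurable] = borel_measurable_measure_fourier[OF M sM] borel_measurable_measure_fourier[OF N sN]
  have large: "V / 2 \<le> cmod (measure_fourier N x)" if x: "norm x < 2 * e" for x
  proof -
    have "AE s in N. 1 / 2 \<le> Re (cis (- 2 * pi * (x \<bullet> s)))"
      unfolding N_def
    proof (subst AE_density, simp, rule AE_I2, rule impI)
      fix s assume "0 < (indicator Q s :: ennreal)"
      then have "s \<in> Q"
        by (cases "s \<in> Q") auto
      then have "norm s \<le> 1 / (12 * e)"
        by (simp add: Q_def)
      then have "\<bar>x \<bullet> s\<bar> \<le> 2 * e * (1 / (12 * e))"
        using x e by (intro order_trans[OF Cauchy_Schwarz_ineq2] mult_mono) auto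
      then have "\<bar>x \<bullet> s\<bar> \<le> 1 / 6"
        using e by simp
      then have "2 * pi * \<bar>x \<bullet> s\<bar> \<le> pi / 3"
        using mult_left_mono[of "\<bar>x \<bullet> s\<bar>" "1 / 6" "2 * pi"] by simp
      then have "cos (pi / 3) \<le> cos (2 * pi * \<bar>x \<bullet> s\<bar>)"
        by (intro cos_monotone_0_pi_le) auto
      also have "cos (2 * pi * \<bar>x \<bullet> s\<bar>) = cos (2 * pi * (x \<bullet> s))"
        by (simp add: abs_if)
      finally show "1 / 2 \<le> Re (cis (- 2 * pi * (x \<bullet> s)))"
        by (simp add: cos_60)
    qed
    then have "(\<integral>s. 1 / 2 \<partial>N) \<le> (\<integral>s. Re (cis (- 2 * pi * (x \<bullet> s))) \<partial>N)"
      by (intro integral_mono_AE integrable_Re N.integrable_cis) auto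
    also have "\<dots> = Re (measure_fourier N x)"
      unfolding measure_fourier_def by (intro integral_Re N.integrable_cis) auto
    also have "\<dots> \<le> cmod (measure_fourier N x)"
      by (rule complex_Re_le_cmod)
    finally show ?thesis
      using V spN by (simp add: measure_def)
  qed
  \<comment> \<open>Markov's inequality: the squared transform of \<open>N\<close> at the difference
    is at least \<open>(V / 2)\<^sup>2\<close> on every close pair.\<close>
  have "ennreal ((V / 2)\<^sup>2) * ?X = (\<integral>\<^sup>+p. ennreal ((V / 2)\<^sup>2) * indicator {p. dist (fst p) (snd p) < 2 * e} p \<partial>(M \<Otimes>\<^sub>M M))"
  proof (rule nn_integral_cmult_indicator[symmetric])
    have "{p \<in> space (M \<Otimes>\<^sub>M M). dist (fst p) (snd p) < 2 * e} \<in> sets (M \<Otimes>\<^sub>M M)"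
      by measurable
    then show "{p. dist (fst p) (snd p) < 2 * e} \<in> sets (M \<Otimes>\<^sub>M M)"
      using sets_eq_imp_space_eq[OF sM] by (simp add: space_pair_measure)
  qed
  also have "\<dots> \<le> (\<integral>\<^sup>+p. ennreal ((cmod (measure_fourier N (fst p - snd p)))\<^sup>2) \<partial>(M \<Otimes>\<^sub>M M))"
  proof (rule nn_integral_mono)
    fix p
    show "ennreal ((V / 2)\<^sup>2) * indicator {p. dist (fst p) (snd p) < 2 * e} p
      \<le> ennreal ((cmod (measure_fourier N (fst p - snd p)))\<^sup>2)"
    proof (cases "dist (fst p) (snd p) < 2 * e")
      case True
      then have "(V / 2)\<^sup>2 \<le> (cmod (measure_fourier N (fst p - snd p)))\<^sup>2"
        using V(2) by (intro power_mono large) (auto simp: dist_norm)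
      then show ?thesis
        using True by (simp add: ennreal_leI)
    qed simp
  qed
  also have "\<dots> = (\<integral>\<^sup>+q. ennreal ((cmod (measure_fourier M (fst q - snd q)))\<^sup>2) \<partial>(N \<Otimes>\<^sub>M N))"
    by (rule measure_fourier_duality[OF M sM N sN])
  also have "\<dots> \<le> ennreal V * ?E"
    unfolding V(1)[symmetric] N_def
    using N by (intro nn_integral_difference_restricted_le) (auto simp: N_def)
  \<comment> \<open>The factor \<open>4 / V\<close> reduces \<open>(V / 2)\<^sup>2\<close> to
    \<open>V\<close> on the left and \<open>V\<close> to 4 on the right.\<close>
  finally have "ennreal (4 / V) * (ennreal ((V / 2)\<^sup>2) * ?X) \<le> ennreal (4 / V) * (ennreal V * ?E)"
    by (rule mult_left_mono) simp
  moreover have "ennreal (4 / V) * (ennreal ((V / 2)\<^sup>2) * ?X) = ennreal V * ?X"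
    using V by (simp add: power2_eq_square flip: mult.assoc ennreal_mult)
  moreover have "ennreal (4 / V) * (ennreal V * ?E) = 4 * ?E"
    using V by (simp flip: mult.assoc ennreal_mult)
  ultimately have "ennreal V * ?X \<le> 4 * ?E"
    by simp
  then show ?thesis
    unfolding Q_def[symmetric] V(1) by (subst mult.commute)
qed

section \<open>Averages over balls\<close>

text \<open>The squared mass of a ball is the product mass of the pairs inside it. After exchanging
  integrals, a pair contributes the volume of the centres within \<open>e\<close> of both points: at
  most one ball volume, and zero unless the points are less than \<open>2 * e\<close> apart.\<close>

lemma nn_integral_ball_measure_square:
  fixes M :: "'a::euclidean_space measure"
  assumes M: "finite_measure M" and sM [measurable_cong]: "sets M = sets borel" and e: "0 \<le> e"
  shows "(\<integral>\<^sup>+x. (emeasure M (ball x e))\<^sup>2 \<partial>lborel)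
    \<le> ennreal (unit_ball_vol DIM('a) * e ^ DIM('a)) * emeasure (M \<Otimes>\<^sub>M M) {p. dist (fst p) (snd p) < 2 * e}"
proof -
  interpret finite_measure M by fact
  interpret MM: finite_measure "M \<Otimes>\<^sub>M M"
    using M by (intro finite_measure_pair_measure)
  interpret L: pair_sigma_finite "M \<Otimes>\<^sub>M M" "lborel :: 'a measure" ..
  have spM: "space M = UNIV"
    using sets_eq_imp_space_eq[OF sM] by simp
  have pred: "{p. dist (fst p) (snd p) < 2 * e} \<in> sets (M \<Otimes>\<^sub>M M)"
  proof -
    have "{p \<in> space (M \<Otimes>\<^sub>M M). dist (fst p) (snd p) < 2 * e} \<in> sets (M \<Otimes>\<^sub>M M)"
      by measurable
    then show ?thesis
      by (simp add: space_pair_measure spM)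
  qed
  define F where "F x p = (if dist x (fst p) < e \<and> dist x (snd p) < e then 1 else 0 :: ennreal)" for x :: 'a and p :: "'a \<times> 'a"
  have [measurable]: "case_prod F \<in> borel_measurable (lborel \<Otimes>\<^sub>M (M \<Otimes>\<^sub>M M))"
      "(\<lambda>(p, x). F x p) \<in> borel_measurable ((M \<Otimes>\<^sub>M M) \<Otimes>\<^sub>M lborel)"
    unfolding F_def by measurable
  have "(emeasure M (ball x e))\<^sup>2 = (\<integral>\<^sup>+p. F x p \<partial>(M \<Otimes>\<^sub>M M))" for x
  proof -
    have "(emeasure M (ball x e))\<^sup>2 = emeasure (M \<Otimes>\<^sub>M M) (ball x e \<times> ball x e)"
      by (simp add: power2_eq_square emeasure_pair_measure_Times sM)
    also have "\<dots> = (\<integral>\<^sup>+p. indicator (ball x e \<times> ball x e) p \<partial>(M \<Otimes>\<^sub>M M))"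
      by (simp add: nn_integral_indicator pair_measureI sM)
    also have "\<dots> = (\<integral>\<^sup>+p. F x p \<partial>(M \<Otimes>\<^sub>M M))"
      by (intro nn_integral_cong) (auto simp: F_def indicator_def)
    finally show ?thesis .
  qed
  then have "(\<integral>\<^sup>+x. (emeasure M (ball x e))\<^sup>2 \<partial>lborel) = (\<integral>\<^sup>+x. \<integral>\<^sup>+p. F x p \<partial>(M \<Otimes>\<^sub>M M) \<partial>lborel)"
    by simp
  also have "\<dots> = (\<integral>\<^sup>+p. \<integral>\<^sup>+x. F x p \<partial>lborel \<partial>(M \<Otimes>\<^sub>M M))"
    by (rule L.Fubini') measurable
  also have "\<dots> \<le> (\<integral>\<^sup>+p. ennreal (unit_ball_vol DIM('a) * e ^ DIM('a)) * indicator {p. dist (fst p) (snd p) < 2 * e} p \<partial>(M \<Otimes>\<^sub>M M))"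
  proof (rule nn_integral_mono)
    fix p :: "'a \<times> 'a"
    have "(\<integral>\<^sup>+x. F x p \<partial>lborel) \<le> (\<integral>\<^sup>+x. indicator {p. dist (fst p) (snd p) < 2 * e} p * indicator (ball (fst p) e) x \<partial>lborel)"
    proof (rule nn_integral_mono)
      fix x
      have "dist (fst p) (snd p) < 2 * e" if "dist x (fst p) < e" "dist x (snd p) < e"
        using that dist_triangle3[of "fst p" "snd p" x] by simp
      then show "F x p \<le> indicator {p. dist (fst p) (snd p) < 2 * e} p * indicator (ball (fst p) e) x"
        by (auto simp: F_def indicator_def dist_commute)
    qed
    also have "\<dots> = indicator {p. dist (fst p) (snd p) < 2 * e} p * ennreal (unit_ball_vol DIM('a) * e ^ DIM('a))"
      using e by (simp add: nn_integral_cmult_indicator emeasure_ball)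
    finally show "(\<integral>\<^sup>+x. F x p \<partial>lborel) \<le> ennreal (unit_ball_vol DIM('a) * e ^ DIM('a)) * indicator {p. dist (fst p) (snd p) < 2 * e} p"
      by (simp add: mult.commute)
  qed
  also have "\<dots> = ennreal (unit_ball_vol DIM('a) * e ^ DIM('a)) * emeasure (M \<Otimes>\<^sub>M M) {p. dist (fst p) (snd p) < 2 * e}"
    by (rule nn_integral_cmult_indicator[OF pred])
  finally show ?thesis .
qed

text \<open>Both sides measure the pairs with \<open>x \<in> U\<close> and
  \<open>dist x y < e\<close>, integrated in opposite orders.\<close>

lemma nn_integral_ball_inter:
  fixes M :: "'a::euclidean_space measure"
  assumes M: "finite_measure M" and sM [measurable_cong]: "sets M = sets borel" and [measurable]: "U \<in> sets borel"
  shows "(\<integral>\<^sup>+y. emeasure lborel (U \<inter> ball y e) \<partial>M) = (\<integral>\<^sup>+x. emeasure M (ball x e) * indicator U x \<partial>lborel)"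
proof -
  interpret finite_measure M by fact
  interpret L: pair_sigma_finite M "lborel :: 'a measure" ..
  define F where "F x y = (if x \<in> U \<and> dist x y < e then 1 else 0 :: ennreal)" for x y :: 'a
  have [measurable]: "case_prod F \<in> borel_measurable (lborel \<Otimes>\<^sub>M M)"
      "(\<lambda>(y, x). F x y) \<in> borel_measurable (M \<Otimes>\<^sub>M lborel)"
    unfolding F_def by measurable
  have "(\<integral>\<^sup>+y. emeasure lborel (U \<inter> ball y e) \<partial>M) = (\<integral>\<^sup>+y. \<integral>\<^sup>+x. F x y \<partial>lborel \<partial>M)"
    by (intro nn_integral_cong, subst nn_integral_indicator[symmetric], simp, intro nn_integral_cong)
       (auto simp: F_def indicator_def dist_commute)
  also have "\<dots> = (\<integral>\<^sup>+x. \<integral>\<^sup>+y. F x y \<partial>M \<partial>lborel)"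
    by (rule L.Fubini'[symmetric]) measurable
  also have "\<dots> = (\<integral>\<^sup>+x. emeasure M (ball x e) * indicator U x \<partial>lborel)"
  proof (intro nn_integral_cong)
    fix x :: 'a
    have "(\<integral>\<^sup>+y. F x y \<partial>M) = (\<integral>\<^sup>+y. indicator U x * indicator (ball x e) y \<partial>M)"
      by (intro nn_integral_cong) (auto simp: F_def indicator_def)
    also have "\<dots> = emeasure M (ball x e) * indicator U x"
      by (simp add: nn_integral_cmult_indicator sM mult.commute)
    finally show "(\<integral>\<^sup>+y. F x y \<partial>M) = emeasure M (ball x e) * indicator U x" .
  qed
  finally show ?thesis .
qed

lemma measurable_emeasure_ball:
  fixes M :: "'a::euclidean_space measure"
  assumes "sigma_finite_measure M" and sM [measurable_cong]: "sets M = sets borel"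
    and [measurable]: "U \<in> sets borel"
  shows "(\<lambda>x. emeasure M (U \<inter> ball x e)) \<in> borel_measurable borel"
proof -
  interpret sigma_finite_measure M by fact
  have "(\<lambda>x. \<integral>\<^sup>+y. (if y \<in> U \<and> dist x y < e then 1 else 0) \<partial>M) \<in> borel_measurable borel"
    by measurable
  moreover have "(\<integral>\<^sup>+y. (if y \<in> U \<and> dist x y < e then 1 else 0) \<partial>M) = emeasure M (U \<inter> ball x e)" for x
    by (subst nn_integral_indicator[symmetric], simp add: sM, intro nn_integral_cong)
       (auto simp: indicator_def)
  ultimately show ?thesis
    by simp
qed

section \<open>From a square-integrable transform to absolute continuity\<close>

text \<open>Quantitative absolute continuity. The ball averages of \<open>M\<close> have squared
  \<open>L\<^sup>2\<close> norm at most \<open>K\<close> at every scale \<open>e\<close>, and a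
  density \<open>f\<close> satisfies \<open>f \<le> t + f\<^sup>2 / t\<close> pointwise. Integrating
  over \<open>U\<close> bounds the averaged mass; Fatou's lemma as \<open>e\<close> tends to 0
  recovers \<open>M\<close> on the open set \<open>U\<close>.\<close>

lemma emeasure_open_le_of_fourier_L2:
  fixes M :: "(real ^ 'n) measure"
  assumes M: "finite_measure M" and sM: "sets M = sets borel"
    and E: "(\<integral>\<^sup>+\<xi>. ennreal ((cmod (measure_fourier M \<xi>))\<^sup>2) \<partial>lborel) < \<infinity>"
  obtains K where "0 \<le> K"
    "\<And>U t. open U \<Longrightarrow> 0 < t \<Longrightarrow> emeasure M U \<le> ennreal t * emeasure lborel U + ennreal (K / t)"
proof -
  interpret finite_measure M by fact
  obtain E where E: "(\<integral>\<^sup>+\<xi>. ennreal ((cmod (measure_fourier M \<xi>))\<^sup>2) \<partial>lborel) = ennreal E" "0 \<le> E"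
    using E by (cases "\<integral>\<^sup>+\<xi>. ennreal ((cmod (measure_fourier M \<xi>))\<^sup>2) \<partial>lborel") auto
  define d where "d = DIM(real ^ 'n)"
  define v where "v = unit_ball_vol (real d)"
  have v: "0 < v"
    by (simp add: v_def)
  \<comment> \<open>\<open>4 * E\<close> and \<open>12 ^ d\<close> come from
    \<open>emeasure_close_pairs_le\<close> with its ball of radius \<open>1 / (12 * e)\<close>;
    dividing by \<open>v\<^sup>2\<close> normalises by the squared volume of the
    \<open>e\<close>-ball, so the powers of \<open>e\<close> cancel.\<close>
  define K where "K = 4 * E * 12 ^ d / v\<^sup>2"
  have K: "0 \<le> K"
    using E v by (simp add: K_def)
  have sq: "(\<integral>\<^sup>+x. (emeasure M (ball x e))\<^sup>2 \<partial>lborel) \<le> ennreal (K * (v * e ^ d)\<^sup>2)" if e: "0 < e" for e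
  proof -
    define X where "X = emeasure (M \<Otimes>\<^sub>M M) {p. dist (fst p) (snd p) < 2 * e}"
    \<comment> \<open>\<open>a\<close> is the volume of the ball of radius
      \<open>1 / (12 * e)\<close>, and \<open>b\<close> is the factor with
      \<open>a * b = v * e ^ d\<close>, so that multiplication replaces division in
      \<open>ennreal\<close>.\<close>
    define a b where "a = v * (1 / (12 * e)) ^ d" and "b = 12 ^ d * e ^ d / v * (v * e ^ d)"
    have ab: "0 \<le> a" "0 \<le> b" "a * b = v * e ^ d" "4 * E * b = K * (v * e ^ d)\<^sup>2"
      using e v by (simp_all add: a_def b_def K_def power_divide power_mult_distrib power2_eq_square field_simps)
    have "X * ennreal a \<le> ennreal (4 * E)"
      using emeasure_close_pairs_le[OF M sM e] e E(2)
      by (simp add: E(1) X_def emeasure_ball v_def d_def a_def ennreal_mult)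
    then have "X * ennreal a * ennreal b \<le> ennreal (4 * E) * ennreal b"
      by (rule mult_right_mono) simp
    moreover have "X * ennreal a * ennreal b = ennreal (v * e ^ d) * X"
      using ab by (simp add: mult.assoc mult.commute[of _ X] flip: ennreal_mult)
    moreover have "ennreal (4 * E) * ennreal b = ennreal (K * (v * e ^ d)\<^sup>2)"
      using ab E(2) by (simp flip: ennreal_mult)
    ultimately have "ennreal (v * e ^ d) * X \<le> ennreal (K * (v * e ^ d)\<^sup>2)"
      by simp
    then show ?thesis
      using nn_integral_ball_measure_square[OF M sM, of e] e by (simp add: X_def v_def d_def)
  qed
  show ?thesis
  proof (rule that[OF K])
    fix U :: "(real ^ 'n) set" and t :: real
    assume U: "open U" and t: "0 < t"
    then have [measurable]: "U \<in> sets borel"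
      by simp
    define B where "B = ennreal t * emeasure lborel U + ennreal (K / t)"
    have avg: "(\<integral>\<^sup>+y. emeasure lborel (U \<inter> ball y e) / ennreal (v * e ^ d) \<partial>M) \<le> B" if e: "0 < e" for e
    proof -
      define V where "V = v * e ^ d"
      have V: "0 < V"
        using v e by (simp add: V_def)
      have [measurable]: "(\<lambda>x. emeasure M (ball x e)) \<in> borel_measurable borel"
          "(\<lambda>x. emeasure lborel (U \<inter> ball x e)) \<in> borel_measurable borel"
        using measurable_emeasure_ball[OF sigma_finite_measure_axioms sM, of UNIV e]
          measurable_emeasure_ball[of lborel U e] by (simp_all add: sigma_finite_lborel)
      have "(\<integral>\<^sup>+y. emeasure lborel (U \<inter> ball y e) \<partial>M) = (\<integral>\<^sup>+x. emeasure M (ball x e) * indicator U x \<partial>lborel)"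
        by (rule nn_integral_ball_inter[OF M sM]) measurable
      also have "\<dots> \<le> (\<integral>\<^sup>+x. ennreal (t * V) * indicator U x + ennreal (1 / (t * V)) * (emeasure M (ball x e))\<^sup>2 \<partial>lborel)"
      proof (rule nn_integral_mono)
        fix x
        define p where "p = measure M (ball x e)"
        \<comment> \<open>The inequality \<open>f \<le> t + f\<^sup>2 / t\<close> for the average
          \<open>f = p / V\<close>, multiplied by \<open>V\<close>; it follows by completing the
          square.\<close>
        have p: "p \<le> t * V + 1 / (t * V) * p\<^sup>2"
        proof -
          have "0 \<le> (p - t * V / 2)\<^sup>2 + 3 / 4 * (t * V)\<^sup>2" by simp
          then have "p * (t * V) \<le> (t * V)\<^sup>2 + p\<^sup>2"
            by (simp add: power2_eq_square field_simps)
          then show ?thesis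
            using t V by (simp add: field_simps power2_eq_square)
        qed
        show "emeasure M (ball x e) * indicator U x \<le> ennreal (t * V) * indicator U x + ennreal (1 / (t * V)) * (emeasure M (ball x e))\<^sup>2"
        proof (cases "x \<in> U")
          case True
          have eM: "emeasure M (ball x e) = ennreal p" and "0 \<le> p"
            by (simp_all add: p_def emeasure_eq_measure)
          then have "ennreal (t * V) + ennreal (1 / (t * V)) * (ennreal p)\<^sup>2 = ennreal (t * V + 1 / (t * V) * p\<^sup>2)"
            using t V by (simp add: ennreal_power ennreal_plus flip: ennreal_mult)
          then show ?thesis
            using True ennreal_leI[OF p] by (simp add: eM)
        qed simp
      qed
      also have "\<dots> = ennreal (t * V) * emeasure lborel U + ennreal (1 / (t * V)) * (\<integral>\<^sup>+x. (emeasure M (ball x e))\<^sup>2 \<partial>lborel)"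
        by (subst nn_integral_add) (auto simp: nn_integral_cmult nn_integral_cmult_indicator)
      also have "\<dots> \<le> ennreal (t * V) * emeasure lborel U + ennreal (1 / (t * V)) * ennreal (K * V\<^sup>2)"
        unfolding V_def using e by (intro add_left_mono mult_left_mono sq) auto
      also have "\<dots> = ennreal V * B"
      proof -
        have "ennreal (t * V) = ennreal V * ennreal t"
          using t V by (simp add: mult.commute flip: ennreal_mult)
        moreover have "ennreal (1 / (t * V)) * ennreal (K * V\<^sup>2) = ennreal V * ennreal (K / t)"
          using t V K by (simp add: power2_eq_square flip: ennreal_mult)
        ultimately show ?thesis
          by (simp add: B_def distrib_left mult.assoc)
      qed
      finally have "(\<integral>\<^sup>+y. emeasure lborel (U \<inter> ball y e) \<partial>M) \<le> ennreal V * B" .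
      then have "(\<integral>\<^sup>+y. emeasure lborel (U \<inter> ball y e) \<partial>M) * inverse (ennreal V) \<le> ennreal V * B * inverse (ennreal V)"
        by (rule mult_right_mono) simp
      also have "\<dots> = B"
        using V by (simp add: inverse_ennreal mult.commute[of _ B] mult.assoc flip: ennreal_mult)
      finally show ?thesis
        by (simp add: divide_ennreal_def V_def[symmetric] nn_integral_multc sM
            measurable_cong_sets[OF sM refl])
    qed
    \<comment> \<open>The fraction of the ball of radius \<open>1 / Suc n\<close> about
      \<open>y\<close> that lies in \<open>U\<close>. As \<open>U\<close> is open, it is eventually
      exactly 1 at points of \<open>U\<close>.\<close>
    define u where "u n y = emeasure lborel (U \<inter> ball y (1 / real (Suc n))) / ennreal (v * (1 / real (Suc n)) ^ d)"
      for n y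
    have [measurable]: "u n \<in> borel_measurable M" for n
      using measurable_emeasure_ball[of lborel U "1 / real (Suc n)"]
      unfolding u_def measurable_cong_sets[OF sM refl] divide_ennreal_def by (simp add: sigma_finite_lborel)
    have "indicator U y \<le> liminf (\<lambda>n. u n y)" for y
    proof (cases "y \<in> U")
      case True
      then obtain r where r: "0 < r" "ball y r \<subseteq> U"
        using U open_contains_ball by blast
      have "eventually (\<lambda>n. 1 / real (Suc n) < r) sequentially"
        using order_tendstoD(2)[OF LIMSEQ_inverse_real_of_nat r(1)] by (simp add: inverse_eq_divide)
      then have "eventually (\<lambda>n. 1 \<le> u n y) sequentially"
      proof eventually_elim
        case (elim n)
        then have "U \<inter> ball y (1 / real (Suc n)) = ball y (1 / real (Suc n))"
          using r(2) subset_ball[of "1 / real (Suc n)" r y] by auto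
        then have "u n y = ennreal (v * (1 / real (Suc n)) ^ d) / ennreal (v * (1 / real (Suc n)) ^ d)"
          by (simp add: u_def emeasure_ball v_def d_def del: of_nat_Suc)
        also have "\<dots> = 1"
          using v by (intro ennreal_divide_self) auto
        finally show ?case
          by simp
      qed
      then show ?thesis
        using True by (simp add: Liminf_bounded)
    qed auto
    then have "(\<integral>\<^sup>+y. indicator U y \<partial>M) \<le> (\<integral>\<^sup>+y. liminf (\<lambda>n. u n y) \<partial>M)"
      by (rule nn_integral_mono)
    then have "emeasure M U \<le> (\<integral>\<^sup>+y. liminf (\<lambda>n. u n y) \<partial>M)"
      by (simp add: sM)
    also have "\<dots> \<le> liminf (\<lambda>n. integral\<^sup>N M (u n))"
      by (rule nn_integral_liminf) measurable
    also have "\<dots> \<le> liminf (\<lambda>n. B)"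
      unfolding u_def by (intro Liminf_mono always_eventually allI avg) simp
    finally show "emeasure M U \<le> ennreal t * emeasure lborel U + ennreal (K / t)"
      by (simp add: B_def Liminf_const)
  qed
qed

text \<open>Outer regularity encloses the null set \<open>S\<close> in open sets of arbitrarily
  small volume; the preceding estimate then bounds its mass by \<open>(1 + K) / t\<close> for every
  \<open>t\<close>.\<close>

lemma emeasure_eq_0_of_fourier_L2:
  fixes M :: "(real ^ 'n) measure"
  assumes M: "finite_measure M" and sM: "sets M = sets borel"
    and E: "(\<integral>\<^sup>+\<xi>. ennreal ((cmod (measure_fourier M \<xi>))\<^sup>2) \<partial>lborel) < \<infinity>"
    and S: "S \<in> sets borel" "emeasure lborel S = 0"
  shows "emeasure M S = 0"
proof -
  interpret finite_measure M by fact
  obtain K where K: "0 \<le> K"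
    "\<And>U t. open U \<Longrightarrow> 0 < t \<Longrightarrow> emeasure M U \<le> ennreal t * emeasure lborel U + ennreal (K / t)"
    by (rule emeasure_open_le_of_fourier_L2[OF M sM E]) (rule that)
  have le: "measure M S \<le> (1 + K) / t" if t: "0 < t" for t
  proof -
    \<comment> \<open>Volume \<open>1 / t\<^sup>2\<close> makes the term
      \<open>t * emeasure lborel U\<close> at most \<open>1 / t\<close>.\<close>
    obtain U where U: "open U" "S \<subseteq> U" "emeasure lborel (U - S) < ennreal (1 / t\<^sup>2)"
      using outer_regular_lborel[OF S(1), of "1 / t\<^sup>2"] t by auto
    have "emeasure lborel U = emeasure lborel (S \<union> (U - S))"
      using U(2) by (simp add: Un_absorb1)
    also have "\<dots> \<le> emeasure lborel S + emeasure lborel (U - S)"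
      using S U(1) by (intro emeasure_subadditive) auto
    also have "\<dots> \<le> ennreal (1 / t\<^sup>2)"
      using S U(3) by simp
    finally have "ennreal t * emeasure lborel U \<le> ennreal t * ennreal (1 / t\<^sup>2)"
      by (rule mult_left_mono) simp
    also have "\<dots> = ennreal (1 / t)"
      using t by (simp add: power2_eq_square flip: ennreal_mult)
    finally have "ennreal t * emeasure lborel U + ennreal (K / t) \<le> ennreal (1 / t) + ennreal (K / t)"
      by (rule add_right_mono)
    with K(2)[OF U(1) t] have "emeasure M U \<le> ennreal (1 / t) + ennreal (K / t)"
      by (rule order_trans)
    then have "emeasure M U \<le> ennreal ((1 + K) / t)"
      using K(1) t by (simp add: add_divide_distrib ennreal_plus)
    then have "emeasure M S \<le> ennreal ((1 + K) / t)"
      using emeasure_mono[OF U(2), of M] U(1) by (auto simp: sM intro: order_trans)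
    then show ?thesis
      using K(1) t by (simp add: emeasure_eq_measure)
  qed
  have "measure M S = 0"
  proof (rule ccontr)
    assume "measure M S \<noteq> 0"
    then have "0 < measure M S"
      by (simp add: zero_less_measure_iff)
    then show False
      \<comment> \<open>For this \<open>t\<close> the bound is half of
        \<open>measure M S\<close>.\<close>
      using le[of "(1 + K) * (2 / measure M S)"] K(1) nonzero_divide_mult_cancel_left[of "1 + K" "2 / measure M S"]
      by simp
  qed
  then show ?thesis
    by (simp add: emeasure_eq_measure)
qed

section \<open>Volume growth and the contradiction\<close>

text \<open>The \<open>R\<close>-balls about the points of \<open>\<Lambda>\<close> in
  \<open>cball 0 (h + R)\<close> cover \<open>cball 0 h\<close>. Their number is at most
  \<open>c * (h + R) powr r\<close>, and \<open>h + R \<le> 2 * h\<close> yields the factor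
  \<open>2 powr r\<close>.\<close>

lemma emeasure_cball_le_of_relatively_dense:
  fixes \<Lambda> :: "'a::euclidean_space set"
  assumes count: "\<And>h x. R \<le> h \<Longrightarrow> emeasure (count_space UNIV) (\<Lambda> \<inter> cball x h) \<le> ennreal (c * h powr r)"
    and R: "0 < R" and c: "0 \<le> c" and r: "0 \<le> r"
    and dense: "\<And>\<xi>. \<exists>\<eta>\<in>\<Lambda>. dist \<xi> \<eta> < R"
    and h: "R \<le> h"
  shows "emeasure lborel (cball 0 h :: 'a set) \<le> ennreal (c * 2 powr r * (unit_ball_vol DIM('a) * R ^ DIM('a)) * h powr r)"
proof -
  define w where "w = unit_ball_vol DIM('a) * R ^ DIM('a)"
  have w: "0 \<le> w"
    using R by (simp add: w_def)
  define F where "F = \<Lambda> \<inter> cball 0 (h + R)"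
  have cF: "emeasure (count_space UNIV) F \<le> ennreal (c * (h + R) powr r)"
    unfolding F_def using h R by (intro count) auto
  then have "finite F"
    by (cases "finite F") (auto simp: top_unique)
  have "cball 0 h \<subseteq> (\<Union>\<eta>\<in>F. ball \<eta> R)"
  proof
    fix \<xi> :: 'a assume \<xi>: "\<xi> \<in> cball 0 h"
    obtain \<eta> where \<eta>: "\<eta> \<in> \<Lambda>" "dist \<xi> \<eta> < R"
      using dense by blast
    moreover have "dist 0 \<eta> \<le> h + R"
      using \<xi> \<eta>(2) dist_triangle[of 0 \<eta> \<xi>] by simp
    ultimately show "\<xi> \<in> (\<Union>\<eta>\<in>F. ball \<eta> R)"
      by (auto simp: F_def dist_commute)
  qed
  then have "emeasure lborel (cball 0 h :: 'a set) \<le> emeasure lborel (\<Union>\<eta>\<in>F. ball \<eta> R)"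
    using \<open>finite F\<close> by (intro emeasure_mono) auto
  also have "\<dots> \<le> (\<Sum>\<eta>\<in>F. emeasure lborel (ball \<eta> R))"
    using \<open>finite F\<close> by (intro emeasure_subadditive_finite) auto
  also have "\<dots> = emeasure (count_space UNIV) F * ennreal w"
    using R \<open>finite F\<close> by (simp add: emeasure_ball w_def)
  also have "\<dots> \<le> ennreal (c * (h + R) powr r) * ennreal w"
    by (rule mult_right_mono[OF cF]) simp
  also have "\<dots> = ennreal (c * (h + R) powr r * w)"
    using c w by (simp add: ennreal_mult)
  also have "\<dots> \<le> ennreal (c * (2 * h) powr r * w)"
    using c w h R r by (intro ennreal_leI mult_right_mono mult_left_mono powr_mono2) auto
  also have "\<dots> = ennreal (c * 2 powr r * w * h powr r)"
    using h R by (simp add: powr_mult mult_ac)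
  finally show ?thesis
    by (simp add: w_def)
qed

theorem proposition1p4:
  fixes \<mu> :: "(real ^ 'n) measure" and C \<gamma> A :: real and \<Lambda> :: "(real ^ 'n) set"
  assumes "sets \<mu> = sets borel" and "finite_measure \<mu>" and "emeasure \<mu> (space \<mu>) \<noteq> 0"
    and "mutually_singular \<mu> lborel"
    and "C > 0"
    and "eventually (\<lambda>\<xi>. (cmod (measure_fourier \<mu> \<xi>))\<^sup>2 \<le> C * norm \<xi> powr (- \<gamma>)) at_infinity"
    and "countable \<Lambda>"
    and "A > 0"
    and "\<And>f. square_integrable \<mu> f \<Longrightarrow>
           ennreal (A * (\<integral>x. (cmod (f x))\<^sup>2 \<partial>\<mu>))
             \<le> (\<Sum>\<^sub>\<infinity>\<xi>\<in>\<Lambda>. ennreal ((cmod (\<integral>x. f x * cis (- 2 * pi * (\<xi> \<bullet> x)) \<partial>\<mu>))\<^sup>2))"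
  shows "ereal \<gamma> \<le> enn2ereal (upper_beurling_dim \<Lambda>)"
proof (rule ccontr)
  assume "\<not> ereal \<gamma> \<le> enn2ereal (upper_beurling_dim \<Lambda>)"
  then have less: "enn2ereal (upper_beurling_dim \<Lambda>) < ereal \<gamma>"
    by simp
  \<comment> \<open>The dimension is nonnegative, so the negated claim forces
    \<open>\<gamma>\<close> to be positive and the comparison can move to
    \<open>ennreal\<close>.\<close>
  then have "0 < ereal \<gamma>"
    using enn2ereal_nonneg le_less_trans by blast
  then have "0 < \<gamma>"
    by simp
  with less have "upper_beurling_dim \<Lambda> < ennreal \<gamma>"
    by (simp add: less_ennreal.rep_eq enn2ereal_ennreal)
  then obtain r where r: "0 < r" "r < \<gamma>" "upper_density r \<Lambda> < \<infinity>"
    unfolding upper_beurling_dim_eq_INF by (auto simp: INF_less_iff ennreal_less_iff)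
  obtain c R0 where c: "0 \<le> c" "0 < R0"
    and count: "\<And>h x. R0 \<le> h \<Longrightarrow> emeasure (count_space UNIV) (\<Lambda> \<inter> cball x h) \<le> ennreal (c * h powr r)"
    by (rule upper_density_finite_count[OF r(3)]) (rule that)
  obtain b where b: "\<And>\<xi>. b \<le> norm \<xi> \<Longrightarrow> (cmod (measure_fourier \<mu> \<xi>))\<^sup>2 \<le> C * norm \<xi> powr (- \<gamma>)"
    using assms(6) by (auto simp: eventually_at_infinity)

  interpret finite_measure \<mu> by (fact assms(2))
  note [measurable_cong] = assms(1)
  define m where "m = measure \<mu> (space \<mu>)"
  have m: "0 < m"
    using assms(3) by (simp add: m_def emeasure_eq_measure zero_less_measure_iff)
  \<comment> \<open>\<open>K c * R powr (r - \<gamma>)\<close> is \<open>C\<close> times the tail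
    bound of \<open>nn_integral_powr_tail\<close>. As \<open>r < \<gamma>\<close>, it drops below
    \<open>A * m\<close> for large \<open>R\<close>.\<close>
  define K where "K c = C * (c * 2 powr r / (1 - 2 powr (r - \<gamma>)))" for c

  have "((\<lambda>R::real. K c * R powr (r - \<gamma>)) \<longlongrightarrow> K c * 0) at_top"
    using r by (intro tendsto_mult tendsto_const tendsto_neg_powr filterlim_ident) auto
  then have "eventually (\<lambda>R::real. K c * R powr (r - \<gamma>) < A * m) at_top"
    using assms(8) m by (intro order_tendstoD(2)) auto
  then have "eventually (\<lambda>R::real. K c * R powr (r - \<gamma>) < A * m \<and> R0 \<le> R \<and> b \<le> R) at_top"
    by (intro eventually_conj eventually_ge_at_top)
  then obtain R where R: "K c * R powr (r - \<gamma>) < A * m" "R0 \<le> R" "b \<le> R"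
    using eventually_happens trivial_limit_at_top_linorder by blast
  have "0 < R"
    using c R by simp
  have bound: "ennreal ((cmod (measure_fourier \<mu> \<xi>))\<^sup>2) \<le> ennreal C * (ennreal (norm \<xi> powr - \<gamma>) * indicator {x. R \<le> norm x} \<xi>)"
    if "R \<le> norm \<xi>" for \<xi>
    using b[of \<xi>] that R assms(5) by (simp add: ennreal_leI flip: ennreal_mult)

  \<comment> \<open>The character of frequency \<open>\<xi>\<close> has squared norm
    \<open>m\<close> and shifts the transform by \<open>\<xi>\<close>. With no point of
    \<open>\<Lambda>\<close> within \<open>R\<close>, the whole frame sum is a tail smaller than
    \<open>A * m\<close>. The same \<open>R\<close> works for all \<open>\<xi>\<close> because
    \<open>count\<close> is uniform in the centre.\<close>
  have dense: "\<exists>\<eta>\<in>\<Lambda>. dist \<xi> \<eta> < R" for \<xi>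
  proof (rule ccontr)
    assume "\<not> (\<exists>\<eta>\<in>\<Lambda>. dist \<xi> \<eta> < R)"
    then have far: "R \<le> norm (\<eta> - \<xi>)" if "\<eta> \<in> \<Lambda>" for \<eta>
      using that by (auto simp: dist_norm norm_minus_commute not_less)
    have "square_integrable \<mu> (\<lambda>x. cis (2 * pi * (\<xi> \<bullet> x)))"
      by (auto simp: square_integrable_def)
    from assms(9)[OF this]
    have "ennreal (A * m) \<le> (\<Sum>\<^sub>\<infinity>\<eta>\<in>\<Lambda>. ennreal ((cmod (\<integral>x. cis (2 * pi * (\<xi> \<bullet> x)) * cis (- 2 * pi * (\<eta> \<bullet> x)) \<partial>\<mu>))\<^sup>2))"
      by (simp add: m_def)
    also have "\<dots> = (\<Sum>\<^sub>\<infinity>\<eta>\<in>\<Lambda>. ennreal ((cmod (measure_fourier \<mu> (\<eta> - \<xi>)))\<^sup>2))"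
      by (simp add: measure_fourier_def cis_mult algebra_simps)
    also have "\<dots> \<le> (\<integral>\<^sup>+\<eta>. ennreal ((cmod (measure_fourier \<mu> (\<eta> - \<xi>)))\<^sup>2) \<partial>count_space \<Lambda>)"
      by (rule infsum_ennreal_le_nn_integral)
    also have "\<dots> \<le> (\<integral>\<^sup>+\<eta>. ennreal C * (ennreal (norm (\<eta> - \<xi>) powr - \<gamma>) * indicator {\<eta>. R \<le> norm (\<eta> - \<xi>)} \<eta>) \<partial>count_space \<Lambda>)"
      using bound far by (intro nn_integral_mono) (fastforce simp: indicator_def)
    also have "\<dots> = ennreal C * (\<integral>\<^sup>+\<eta>. ennreal (norm (\<eta> - \<xi>) powr - \<gamma>) * indicator {\<eta>. R \<le> norm (\<eta> - \<xi>)} \<eta> \<partial>count_space \<Lambda>)"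
      by (intro nn_integral_cmult) simp
    also have "\<dots> \<le> ennreal C * ennreal (c * 2 powr r / (1 - 2 powr (r - \<gamma>)) * R powr (r - \<gamma>))"
    proof (intro mult_left_mono nn_integral_powr_tail)
      fix h assume "R \<le> h"
      have "{\<eta> \<in> space (count_space \<Lambda>). norm (\<eta> - \<xi>) \<le> h} = \<Lambda> \<inter> cball \<xi> h"
        by (auto simp: dist_norm norm_minus_commute)
      moreover have "emeasure (count_space \<Lambda>) (\<Lambda> \<inter> cball \<xi> h) = emeasure (count_space UNIV) (\<Lambda> \<inter> cball \<xi> h)"
        by (cases "finite (\<Lambda> \<inter> cball \<xi> h)") auto
      ultimately show "emeasure (count_space \<Lambda>) {\<eta> \<in> space (count_space \<Lambda>). norm (\<eta> - \<xi>) \<le> h} \<le> ennreal (c * h powr r)"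
        using count[of h \<xi>] R \<open>R \<le> h\<close> by simp
    qed (use \<open>0 < R\<close> c r in auto)
    also have "\<dots> = ennreal (K c * R powr (r - \<gamma>))"
      unfolding K_def using assms(5) by (subst ennreal_mult'[symmetric]) (simp_all add: mult.assoc)
    also have "\<dots> < ennreal (A * m)"
      using R(1) assms(8) m by (intro ennreal_lessI) auto
    finally show False
      by simp
  qed

  define c' where "c' = c * 2 powr r * (unit_ball_vol DIM(real ^ 'n) * R ^ DIM(real ^ 'n))"
  have c': "0 \<le> c'"
    using c \<open>0 < R\<close> by (simp add: c'_def)
  have growth: "emeasure lborel (cball 0 h :: (real ^ 'n) set) \<le> ennreal (c' * h powr r)" if "R \<le> h" for h
    unfolding c'_def
    using count R c r \<open>0 < R\<close> that dense by (intro emeasure_cball_le_of_relatively_dense) auto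

  \<comment> \<open>Inside the ball of radius \<open>R\<close> the transform is bounded by the total
    mass. Outside, its decay and the volume growth of exponent \<open>r < \<gamma>\<close> make the
    tail finite.\<close>
  have "(\<integral>\<^sup>+\<xi>. ennreal ((cmod (measure_fourier \<mu> \<xi>))\<^sup>2) \<partial>lborel)
    \<le> (\<integral>\<^sup>+\<xi>. ennreal (m\<^sup>2) * indicator (ball (0 :: real ^ 'n) R) \<xi>
        + ennreal C * (ennreal (norm \<xi> powr - \<gamma>) * indicator {x. R \<le> norm x} \<xi>) \<partial>lborel)"
  proof (rule nn_integral_mono)
    fix \<xi> :: "real ^ 'n"
    have "(cmod (measure_fourier \<mu> \<xi>))\<^sup>2 \<le> m\<^sup>2"
      unfolding m_def by (intro power_mono cmod_measure_fourier_le assms) auto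
    then show "ennreal ((cmod (measure_fourier \<mu> \<xi>))\<^sup>2) \<le> ennreal (m\<^sup>2) * indicator (ball 0 R) \<xi>
        + ennreal C * (ennreal (norm \<xi> powr - \<gamma>) * indicator {x. R \<le> norm x} \<xi>)"
      using bound[of \<xi>] by (cases "R \<le> norm \<xi>") (auto simp: ennreal_leI)
  qed
  also have "\<dots> = ennreal (m\<^sup>2) * emeasure lborel (ball (0 :: real ^ 'n) R)
      + ennreal C * (\<integral>\<^sup>+\<xi>. ennreal (norm \<xi> powr - \<gamma>) * indicator {x. R \<le> norm x} \<xi> \<partial>(lborel :: (real ^ 'n) measure))"
  proof -
    have [measurable]: "{x :: real ^ 'n. R \<le> norm x} \<in> sets borel" "ball (0 :: real ^ 'n) R \<in> sets borel"
      by (auto intro!: borel_closed closed_Collect_le continuous_intros)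
    have "(\<lambda>\<xi>. ennreal (m\<^sup>2) * indicator (ball (0 :: real ^ 'n) R) \<xi>) \<in> borel_measurable lborel"
      "(\<lambda>\<xi> :: real ^ 'n. ennreal (norm \<xi> powr - \<gamma>) * indicator {x. R \<le> norm x} \<xi>) \<in> borel_measurable lborel"
      by measurable
    then show ?thesis
      by (simp add: nn_integral_add nn_integral_cmult nn_integral_cmult_indicator)
  qed
  also have "\<dots> \<le> ennreal (m\<^sup>2) * emeasure lborel (ball (0 :: real ^ 'n) R)
      + ennreal C * ennreal (c' * 2 powr r / (1 - 2 powr (r - \<gamma>)) * R powr (r - \<gamma>))"
  proof (intro add_left_mono mult_left_mono nn_integral_powr_tail)
    fix h assume "R \<le> h"
    have "{x \<in> space lborel. norm x \<le> h} = cball (0 :: real ^ 'n) h"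
      by auto
    then show "emeasure lborel {x \<in> space lborel. norm (x :: real ^ 'n) \<le> h} \<le> ennreal (c' * h powr r)"
      using growth[OF \<open>R \<le> h\<close>] by simp
  qed (use \<open>0 < R\<close> c' r in auto)
  also have "\<dots> < \<infinity>"
    using emeasure_lborel_ball_finite[of "0 :: real ^ 'n" R] by (simp add: ennreal_mult_less_top)
  finally have L2: "(\<integral>\<^sup>+\<xi>. ennreal ((cmod (measure_fourier \<mu> \<xi>))\<^sup>2) \<partial>lborel) < \<infinity>" .

  \<comment> \<open>\<open>S\<close> carries all of \<open>\<mu>\<close> yet is Lebesgue null, so
    absolute continuity would make \<open>\<mu>\<close> zero.\<close>
  obtain S where S: "S \<in> sets \<mu>" "emeasure \<mu> (space \<mu> - S) = 0" "emeasure lborel S = 0"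
    using assms(4) by (auto simp: mutually_singular_def)
  have "emeasure \<mu> S = 0"
    using S assms(1) by (intro emeasure_eq_0_of_fourier_L2[OF assms(2,1) L2]) auto
  moreover have "emeasure \<mu> (space \<mu>) \<le> emeasure \<mu> S + emeasure \<mu> (space \<mu> - S)"
    using S(1) emeasure_subadditive[of S \<mu> "space \<mu> - S"] sets.sets_into_space[OF S(1)]
    by (simp add: Un_absorb1)
  ultimately show False
    using S(2) assms(3) by simp
qed

end
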